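(* Let $X\subset\mathbb{A}^4_{\mathbb{C}}=\mathrm{Spec}(\mathbb{C}[x,y,z,t])$ be the Koras-Russell cubic threefold, i.e. the affine hypersurface defined by the equation $x+x^2y+z^2+t^3=0$. Then the cylinder $X\times\mathbb{A}^1$ has trivial Makar-Limanov invariant: $\mathrm{ML}(X\times\mathbb{A}^1)=\mathbb{C}$. Here $X\times\mathbb{A}^1$ is the affine variety with coordinate ring $\mathbb{C}[x,y,z,t,w]/(x+x^2y+z^2+t^3)$.
   Context: All varieties are over $\mathbb{C}$. For an affine variety $V$ with coordinate ring $\mathbb{C}[V]$, a $\mathbb{C}$-derivation $\partial:\mathbb{C}[V]\to\mathbb{C}[V]$ is called locally nilpotent if for every $f\in\mathbb{C}[V]$ there exists $n\ge 1$ with $\partial^n(f)=0$. The Makar-Limanov invariant $\mathrm{ML}(V)\subset\mathbb{C}[V]$ is the subalgebra $\bigcap_{\partial}\mathrm{Ker}(\partial)$, where $\partial$ runs over all locally nilpotent $\mathbb{C}$-derivations of $\mathbb{C}[V]$. Equivalently, it is the algebra of regular functions on $V$ that are invariant under all algebraic actions of the additive group $\mathbb{G}_a$ on $V$. The equality $\mathrm{ML}(V)=\mathbb{C}$ means that $\mathrm{ML}(V)$ consists of the constant functions only. *)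

theory Defs
  imports "HOL-Computational_Algebra.Polynomial"
begin

text \<open>An algebra over the complex numbers is given by its structure map, whose image consists
  of the constants.\<close>

class complex_algebra = comm_ring_1 +
  fixes of_complex :: "complex \<Rightarrow> 'a"
  assumes of_complex_add: "of_complex (a + b) = of_complex a + of_complex b"
    and of_complex_mult: "of_complex (a * b) = of_complex a * of_complex b"
    and of_complex_1: "of_complex 1 = 1"

instantiation complex :: complex_algebra
begin

definition of_complex_complex :: "complex \<Rightarrow> complex"
  where "of_complex_complex c = c"

instance
  by standard (simp_all add: of_complex_complex_def)

end

instantiation poly :: (complex_algebra) complex_algebra
begin

definition of_complex_poly :: "complex \<Rightarrow> 'a poly"
  where "of_complex_poly c = [:of_complex c:]"

instance
  by standard
    (simp_all add: of_complex_poly_def of_complex_add of_complex_mult of_complex_1 one_pCons)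

end

definition complex_derivation :: "('a::complex_algebra \<Rightarrow> 'a) \<Rightarrow> bool"
  where "complex_derivation D \<longleftrightarrow>
    (\<forall>f g. D (f + g) = D f + D g) \<and>
    (\<forall>c f. D (of_complex c * f) = of_complex c * D f) \<and>
    (\<forall>f g. D (f * g) = f * D g + D f * g)"

definition locally_nilpotent :: "('a::zero \<Rightarrow> 'a) \<Rightarrow> bool"
  where "locally_nilpotent D \<longleftrightarrow> (\<forall>f. \<exists>n\<ge>1. (D ^^ n) f = 0)"

definition makar_limanov :: "'a::complex_algebra set"
  where "makar_limanov =
    (\<Inter>D\<in>{D. complex_derivation D \<and> locally_nilpotent D}. {f. D f = 0})"

text \<open>The ring of polynomials in \<open>x, y, z, t, w\<close> is the iterated polynomial ring
  with \<open>x\<close> as innermost and \<open>w\<close> as outermost variable.\<close>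

type_synonym poly5 = "complex poly poly poly poly poly"

definition var_x :: poly5 where "var_x = [:[:[:[:[:0, 1:]:]:]:]:]"
definition var_y :: poly5 where "var_y = [:[:[:[:0, 1:]:]:]:]"
definition var_z :: poly5 where "var_z = [:[:[:0, 1:]:]:]"
definition var_t :: poly5 where "var_t = [:[:0, 1:]:]"
definition var_w :: poly5 where "var_w = [:0, 1:]"

definition koras_russell_poly :: poly5
  where "koras_russell_poly = var_x + var_x ^ 2 * var_y + var_z ^ 2 + var_t ^ 3"

definition koras_russell_cong :: "poly5 \<Rightarrow> poly5 \<Rightarrow> bool"
  where "koras_russell_cong p q \<longleftrightarrow> koras_russell_poly dvd p - q"

lemma dvd_diff_sym:
  fixes f p q :: "'a::comm_ring_1"
  assumes "f dvd p - q"
  shows "f dvd q - p"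
  using assms dvd_minus_iff[of f "p - q"] by simp

lemma dvd_diff_trans:
  fixes f p q r :: "'a::comm_ring_1"
  assumes "f dvd p - q" "f dvd q - r"
  shows "f dvd p - r"
  using dvd_add[OF assms] by simp

lemma dvd_diff_cong_add:
  fixes f a b c d :: "'a::comm_ring_1"
  assumes "f dvd a - b" "f dvd c - d"
  shows "f dvd (a + c) - (b + d)"
  using dvd_add[OF assms] by (simp add: algebra_simps)

lemma dvd_diff_cong_diff:
  fixes f a b c d :: "'a::comm_ring_1"
  assumes "f dvd a - b" "f dvd c - d"
  shows "f dvd (a - c) - (b - d)"
  using dvd_diff[OF assms] by (simp add: algebra_simps)

lemma dvd_diff_cong_uminus:
  fixes f a b :: "'a::comm_ring_1"
  assumes "f dvd a - b"
  shows "f dvd (- a) - (- b)"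
  using dvd_diff_sym[OF assms] by simp

lemma dvd_diff_cong_mult:
  fixes f a b c d :: "'a::comm_ring_1"
  assumes "f dvd a - b" "f dvd c - d"
  shows "f dvd a * c - b * d"
proof -
  have "f dvd (a - b) * c + (c - d) * b"
    using assms by (intro dvd_add dvd_mult2)
  then show ?thesis
    by (simp add: algebra_simps)
qed

lemma equivp_koras_russell_cong: "equivp koras_russell_cong"
proof (rule equivpI)
  show "reflp koras_russell_cong"
    unfolding koras_russell_cong_def by (rule reflpI) (simp only: diff_self dvd_0_right)
  show "symp koras_russell_cong"
    unfolding koras_russell_cong_def by (rule sympI) (rule dvd_diff_sym)
  show "transp koras_russell_cong"
    unfolding koras_russell_cong_def by (rule transpI) (rule dvd_diff_trans)
qed

lemma not_koras_russell_poly_dvd_1: "\<not> koras_russell_poly dvd 1"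
proof
  define ev :: "poly5 \<Rightarrow> complex"
    where "ev p = poly (poly (poly (poly (poly p 0) 0) 0) 0) 0" for p
  have ev_hom: "ev (p + q) = ev p + ev q" "ev (p * q) = ev p * ev q" "ev (p ^ n) = ev p ^ n" for p q n
    unfolding ev_def by (simp_all only: poly_add poly_mult poly_power)
  have ev_var: "ev var_x = 0" "ev var_z = 0" "ev var_t = 0"
    unfolding ev_def var_x_def var_z_def var_t_def
    by (simp_all only: poly_pCons poly_0 mult_zero_left mult_zero_right add_0_right)
  have "ev koras_russell_poly = 0"
    unfolding koras_russell_poly_def ev_hom ev_var by simp
  assume "koras_russell_poly dvd 1"
  then obtain q where "1 = koras_russell_poly * q" ..
  then have "ev 1 = ev koras_russell_poly * ev q"
    using ev_hom(2) by metis
  moreover have "ev 1 = 1"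
    unfolding ev_def by (simp only: poly_1)
  ultimately show False
    using \<open>ev koras_russell_poly = 0\<close> by simp
qed

quotient_type koras_russell_cylinder = poly5 / koras_russell_cong
  by (rule equivp_koras_russell_cong)

instantiation koras_russell_cylinder :: complex_algebra
begin

lift_definition zero_koras_russell_cylinder :: koras_russell_cylinder is 0 .

lift_definition one_koras_russell_cylinder :: koras_russell_cylinder is 1 .

lift_definition plus_koras_russell_cylinder ::
    "koras_russell_cylinder \<Rightarrow> koras_russell_cylinder \<Rightarrow> koras_russell_cylinder" is "(+)"
  unfolding koras_russell_cong_def by (rule dvd_diff_cong_add)

lift_definition minus_koras_russell_cylinder ::
    "koras_russell_cylinder \<Rightarrow> koras_russell_cylinder \<Rightarrow> koras_russell_cylinder" is "(-)"
  unfolding koras_russell_cong_def by (rule dvd_diff_cong_diff)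

lift_definition uminus_koras_russell_cylinder ::
    "koras_russell_cylinder \<Rightarrow> koras_russell_cylinder" is "uminus"
  unfolding koras_russell_cong_def by (rule dvd_diff_cong_uminus)

lift_definition times_koras_russell_cylinder ::
    "koras_russell_cylinder \<Rightarrow> koras_russell_cylinder \<Rightarrow> koras_russell_cylinder" is "(*)"
  unfolding koras_russell_cong_def by (rule dvd_diff_cong_mult)

lift_definition of_complex_koras_russell_cylinder :: "complex \<Rightarrow> koras_russell_cylinder"
  is of_complex .

instance
proof
  fix a b c :: koras_russell_cylinder and u v :: complex
  have refl: "koras_russell_cong p q" if "p = q" for p q
    unfolding koras_russell_cong_def that by (simp only: diff_self dvd_0_right)
  show "a + b + c = a + (b + c)"
    by transfer (rule refl, rule add.assoc)
  show "a + b = b + a"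
    by transfer (rule refl, rule add.commute)
  show "0 + a = a"
    by transfer (rule refl, rule add_0_left)
  show "- a + a = 0"
    by transfer (rule refl, rule left_minus)
  show "a - b = a + - b"
    by transfer (rule refl, rule diff_conv_add_uminus)
  show "a * b * c = a * (b * c)"
    by transfer (rule refl, rule mult.assoc)
  show "a * b = b * a"
    by transfer (rule refl, rule mult.commute)
  show "1 * a = a"
    by transfer (rule refl, rule mult_1_left)
  show "(a + b) * c = a * c + b * c"
    by transfer (rule refl, rule distrib_right)
  show "(0::koras_russell_cylinder) \<noteq> 1"
  proof transfer
    show "\<not> koras_russell_cong 0 1"
      using not_koras_russell_poly_dvd_1
      unfolding koras_russell_cong_def diff_0 dvd_minus_iff .
  qed
  show "(of_complex (u + v) :: koras_russell_cylinder) = of_complex u + of_complex v"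
    by transfer (rule refl, rule of_complex_add)
  show "(of_complex (u * v) :: koras_russell_cylinder) = of_complex u * of_complex v"
    by transfer (rule refl, rule of_complex_mult)
  show "(of_complex 1 :: koras_russell_cylinder) = 1"
    by transfer (rule refl, rule of_complex_1)
qed

end

end

theory Submission
  imports Defs
begin

text \<open>Functions killed by the locally nilpotent derivations \<open>\<partial>\<^sub>w\<close>, \<open>x\<^sup>2 \<partial>\<^sub>z - 2 z \<partial>\<^sub>y\<close> and
  \<open>x\<^sup>2 \<partial>\<^sub>t - 3 t\<^sup>2 \<partial>\<^sub>y\<close> are constant on the fibres of \<open>x\<close> over \<open>x \<noteq> 0\<close>, hence polynomials in \<open>x\<close>,
  because the threefold has a section over the \<open>x\<close>-line. It remains to find a locally nilpotent
  derivation that does not kill \<open>x\<close>. Over the field \<open>\<complex>(t)\<close> the threefold is the surface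
  \<open>x\<^sup>2 y + x + z\<^sup>2 + t\<^sup>3 = 0\<close>, and Danielewski's fibre product trick identifies its cylinder with the
  cylinder over \<open>x s = v\<^sup>2 + t\<^sup>3\<close>, where \<open>2 v \<partial>\<^sub>x + s \<partial>\<^sub>v\<close> is such a derivation. As \<open>t\<close> is in its
  kernel, a multiple by a power of \<open>t\<close> acts on the coordinate ring over \<open>\<complex>\<close>.\<close>

section \<open>Derivations\<close>

lemma of_complex_0 [simp]: "of_complex 0 = (0 :: 'a::complex_algebra)"
  using of_complex_add[of 0 0, where 'a = 'a] by simp

lemma
  assumes "complex_derivation D"
  shows derivation_add: "D (f + g) = D f + D g"
    and derivation_mult: "D (f * g) = f * D g + D f * g"
    and derivation_scale: "D (of_complex c * f) = of_complex c * D f"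
  using assms by (auto simp: complex_derivation_def)

lemma derivation_0: "complex_derivation D \<Longrightarrow> D 0 = 0"
  using derivation_add[of D 0 0] by simp

lemma derivation_of_complex:
  assumes "complex_derivation D"
  shows "D (of_complex c) = 0"
proof -
  have "D 1 = 0"
    using derivation_mult[OF assms, of 1 1] by simp
  then show ?thesis
    using derivation_scale[OF assms, of c 1] by simp
qed

lemma derivation_1: "complex_derivation D \<Longrightarrow> D 1 = 0"
  using derivation_of_complex[of D 1] by (simp add: of_complex_1)

lemma derivation_minus:
  assumes "complex_derivation D"
  shows "D (- f) = - D f"
  using derivation_add[OF assms, of f "- f"] derivation_0[OF assms]
  by (simp add: eq_neg_iff_add_eq_0 add.commute)

lemma derivation_diff: "complex_derivation D \<Longrightarrow> D (f - g) = D f - D g"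
  using derivation_add[of D f "- g"] derivation_minus[of D g] by simp

lemma derivation_numeral:
  assumes "complex_derivation D"
  shows "D (numeral n) = 0"
  by (induction n)
     (simp_all only: numeral_One numeral_Bit0 numeral_Bit1 derivation_add[OF assms]
       derivation_1[OF assms] add_0_left)

lemma derivation_power2:
  assumes "complex_derivation D"
  shows "D (f ^ 2) = 2 * f * D f"
  unfolding power2_eq_square derivation_mult[OF assms] mult_2 distrib_right
  by (simp only: mult.commute)

lemma derivation_power3:
  assumes "complex_derivation D"
  shows "D (f ^ 3) = 3 * f ^ 2 * D f"
proof -
  have "3 * f ^ 2 * D f = f ^ 2 * D f + 2 * f ^ 2 * D f"
    by (simp flip: distrib_right)
  then show ?thesis
    unfolding power3_eq_cube power2_eq_square derivation_mult[OF assms] mult_2 distrib_right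
    by (simp only: mult_ac add_ac)
qed

lemma complex_derivation_pderiv:
  "complex_derivation (pderiv :: 'a::{complex_algebra, idom} poly \<Rightarrow> 'a poly)"
  unfolding complex_derivation_def of_complex_poly_def
  by (simp add: pderiv_add pderiv_mult pderiv_smult algebra_simps)

text \<open>The Leibniz rule passes to coefficients because each coefficient of a product is a
  finite sum of products. Iterating this yields the partial derivatives in the inner
  variables.\<close>

lemma complex_derivation_map_poly:
  fixes D :: "'a::complex_algebra \<Rightarrow> 'a"
  assumes D: "complex_derivation D"
  shows "complex_derivation (map_poly D)"
proof -
  have coeff: "coeff (map_poly D p) n = D (coeff p n)" for p n
    using derivation_0[OF D] by (simp add: coeff_map_poly)
  have sum: "D (sum h A) = (\<Sum>i\<in>A. D (h i))" for h :: "nat \<Rightarrow> 'a" and A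
    using sum_comp_morphism[of D h A] derivation_0[OF D] derivation_add[OF D] by (simp add: o_def)
  show ?thesis
    unfolding complex_derivation_def
    by (auto intro!: poly_eqI simp: coeff derivation_add[OF D] derivation_scale[OF D]
        derivation_of_complex[OF D] derivation_mult[OF D] coeff_mult sum sum.distrib
        of_complex_poly_def)
qed

lemma complex_derivation_plus:
  assumes D: "complex_derivation D" and E: "complex_derivation E"
  shows "complex_derivation (\<lambda>p. D p + E p)"
  unfolding complex_derivation_def
proof (intro conjI allI)
  fix f g c
  show "D (f + g) + E (f + g) = D f + E f + (D g + E g)"
    by (simp add: derivation_add[OF D] derivation_add[OF E])
  show "D (of_complex c * f) + E (of_complex c * f) = of_complex c * (D f + E f)"
    by (simp only: derivation_scale[OF D] derivation_scale[OF E] distrib_left)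
  show "D (f * g) + E (f * g) = f * (D g + E g) + (D f + E f) * g"
    by (simp add: derivation_mult[OF D] derivation_mult[OF E] algebra_simps)
qed

lemma complex_derivation_times:
  assumes D: "complex_derivation D"
  shows "complex_derivation (\<lambda>p. b * D p)"
  unfolding complex_derivation_def
proof (intro conjI allI)
  fix f g c
  show "b * D (f + g) = b * D f + b * D g"
    by (simp only: derivation_add[OF D] distrib_left)
  show "b * D (of_complex c * f) = of_complex c * (b * D f)"
    by (simp only: derivation_scale[OF D] mult.left_commute)
  show "b * D (f * g) = f * (b * D g) + b * D f * g"
    by (simp add: derivation_mult[OF D] algebra_simps)
qed

section \<open>Elements annihilated by some power of a derivation\<close>

definition nilpotent_part :: "('a::zero \<Rightarrow> 'a) \<Rightarrow> 'a set"
  where "nilpotent_part D = {f. \<exists>n. (D ^^ n) f = 0}"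

text \<open>\<open>nilpotent_part\<close> admits the exponent 0; the bound \<open>n \<ge> 1\<close>
  is regained by one further application, since \<open>D 0 = 0\<close>.\<close>

lemma locally_nilpotentI:
  assumes "D 0 = 0" "\<And>f. f \<in> nilpotent_part D"
  shows "locally_nilpotent D"
  unfolding locally_nilpotent_def
proof
  fix f
  obtain n where "(D ^^ n) f = 0"
    using assms(2)[of f] by (auto simp: nilpotent_part_def)
  then have "(D ^^ Suc n) f = 0"
    using assms(1) by simp
  then show "\<exists>n\<ge>1. (D ^^ n) f = 0"
    by (intro exI[of _ "Suc n"]) simp
qed

context
  fixes D :: "'a::complex_algebra \<Rightarrow> 'a"
  assumes D: "complex_derivation D"
begin

lemma derivation_funpow_0: "(D ^^ n) 0 = 0"
  by (induction n) (simp_all add: derivation_0[OF D])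

lemma derivation_funpow_add: "(D ^^ n) (f + g) = (D ^^ n) f + (D ^^ n) g"
  by (induction n) (simp_all add: derivation_add[OF D])

lemma derivation_funpow_mono: "(D ^^ n) f = 0 \<Longrightarrow> n \<le> m \<Longrightarrow> (D ^^ m) f = 0"
  using derivation_funpow_0[of "m - n"] funpow_add[of "m - n" n D] by simp

text \<open>One application of \<open>D\<close> splits \<open>f * g\<close> into
  \<open>f * D g\<close> and \<open>D f * g\<close>, each with total exponent one lower, so no
  binomial formula is needed. If an exponent is 0, the corresponding factor is zero.\<close>

lemma derivation_funpow_mult:
  "(D ^^ n) f = 0 \<Longrightarrow> (D ^^ m) g = 0 \<Longrightarrow> (D ^^ (n + m)) (f * g) = 0"
proof (induction "n + m" arbitrary: n m f g)
  case 0
  then show ?case by simp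
next
  case (Suc k)
  show ?case
  proof (cases "n = 0 \<or> m = 0")
    case True
    then have "f * g = 0"
      using Suc.prems by auto
    then show ?thesis
      by (simp only: derivation_funpow_0)
  next
    case False
    then obtain n' m' where nm: "n = Suc n'" "m = Suc m'"
      by (meson not0_implies_Suc)
    have k: "k = n + m'" "k = n' + m"
      using nm Suc.hyps(2) by simp_all
    have "(D ^^ m') (D g) = 0" "(D ^^ n') (D f) = 0"
      using Suc.prems nm by (simp_all add: funpow_swap1)
    then have "(D ^^ k) (f * D g) = 0" "(D ^^ k) (D f * g) = 0"
      using Suc.hyps(1) Suc.prems k by metis+
    then have "(D ^^ k) (D (f * g)) = 0"
      by (simp add: derivation_mult[OF D] derivation_funpow_add)
    then show ?thesis
      using Suc.hyps(2) by (metis comp_apply funpow_Suc_right)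
  qed
qed

lemma nilpotent_part_add:
  assumes "f \<in> nilpotent_part D" "g \<in> nilpotent_part D"
  shows "f + g \<in> nilpotent_part D"
proof -
  obtain n m where "(D ^^ n) f = 0" "(D ^^ m) g = 0"
    using assms by (auto simp: nilpotent_part_def)
  then have "(D ^^ max n m) f = 0" "(D ^^ max n m) g = 0"
    by (meson derivation_funpow_mono max.cobounded1 max.cobounded2)+
  then show ?thesis
    unfolding nilpotent_part_def by (auto intro!: exI[of _ "max n m"] simp: derivation_funpow_add)
qed

lemma nilpotent_part_mult:
  "f \<in> nilpotent_part D \<Longrightarrow> g \<in> nilpotent_part D \<Longrightarrow> f * g \<in> nilpotent_part D"
  using derivation_funpow_mult by (fastforce simp: nilpotent_part_def)

text \<open>Lets nilpotency climb along a triangular derivation: kernel elements first, then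
  elements sent to those already reached.\<close>

lemma nilpotent_part_step: "D f \<in> nilpotent_part D \<Longrightarrow> f \<in> nilpotent_part D"
  by (auto simp: nilpotent_part_def simp flip: funpow_swap1 intro: exI[of _ "Suc _"])

lemma nilpotent_part_kernel: "D f = 0 \<Longrightarrow> f \<in> nilpotent_part D"
  by (auto simp: nilpotent_part_def intro!: exI[of _ 1])

lemma nilpotent_part_of_complex: "of_complex c \<in> nilpotent_part D"
  by (rule nilpotent_part_kernel) (rule derivation_of_complex[OF D])

lemma nilpotent_part_1: "1 \<in> nilpotent_part D"
  by (rule nilpotent_part_kernel) (rule derivation_1[OF D])

lemma nilpotent_part_numeral: "numeral n \<in> nilpotent_part D"
  by (rule nilpotent_part_kernel) (rule derivation_numeral[OF D])

lemma nilpotent_part_minus: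
  assumes "f \<in> nilpotent_part D"
  shows "- f \<in> nilpotent_part D"
proof -
  have "- 1 \<in> nilpotent_part D"
    by (rule nilpotent_part_kernel) (simp add: derivation_minus[OF D] derivation_1[OF D])
  from nilpotent_part_mult[OF this assms] show ?thesis
    by simp
qed

lemma nilpotent_part_diff:
  "f \<in> nilpotent_part D \<Longrightarrow> g \<in> nilpotent_part D \<Longrightarrow> f - g \<in> nilpotent_part D"
  using nilpotent_part_add[of f "- g"] nilpotent_part_minus by simp

lemma nilpotent_part_power: "f \<in> nilpotent_part D \<Longrightarrow> f ^ n \<in> nilpotent_part D"
  by (induction n) (simp_all add: nilpotent_part_1 nilpotent_part_mult)

lemmas nilpotent_part_closed = nilpotent_part_add nilpotent_part_mult nilpotent_part_minus
  nilpotent_part_diff nilpotent_part_power nilpotent_part_1 nilpotent_part_numeral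

end

section \<open>Polynomials in five variables\<close>

lemma of_complex_poly5: "(of_complex c :: poly5) = [:[:[:[:[:c:]:]:]:]:]"
  by (simp add: of_complex_poly_def of_complex_complex_def)

text \<open>The constants and the five variables generate the ring. The proof adds one variable at a
  time, from the innermost \<open>x\<close> outwards.\<close>

lemma poly5_induct [case_names const x y z t w add mult]:
  fixes P :: "poly5 \<Rightarrow> bool"
  assumes const: "\<And>c. P (of_complex c)"
    and x: "P var_x" and y: "P var_y" and z: "P var_z" and t: "P var_t" and w: "P var_w"
    and add: "\<And>p q. P p \<Longrightarrow> P q \<Longrightarrow> P (p + q)"
    and mult: "\<And>p q. P p \<Longrightarrow> P q \<Longrightarrow> P (p * q)"
  shows "P p"
proof -
  have 0: "P 0"
    using const[of 0] by simp
  have 1: "P [:[:[:[:p:]:]:]:]" for p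
  proof (induction p)
    case (pCons a p)
    have "[:[:[:[:pCons a p:]:]:]:] = of_complex a + var_x * [:[:[:[:p:]:]:]:]"
      by (simp add: of_complex_poly5 var_x_def)
    then show ?case
      using add[OF const mult[OF x pCons.IH]] by metis
  qed (simp add: 0)
  have 2: "P [:[:[:p:]:]:]" for p
  proof (induction p)
    case (pCons a p)
    have "[:[:[:pCons a p:]:]:] = [:[:[:[:a:]:]:]:] + var_y * [:[:[:p:]:]:]"
      by (simp add: var_y_def)
    then show ?case
      using add[OF 1 mult[OF y pCons.IH]] by metis
  qed (simp add: 0)
  have 3: "P [:[:p:]:]" for p
  proof (induction p)
    case (pCons a p)
    have "[:[:pCons a p:]:] = [:[:[:a:]:]:] + var_z * [:[:p:]:]"
      by (simp add: var_z_def)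
    then show ?case
      using add[OF 2 mult[OF z pCons.IH]] by metis
  qed (simp add: 0)
  have 4: "P [:p:]" for p
  proof (induction p)
    case (pCons a p)
    have "[:pCons a p:] = [:[:a:]:] + var_t * [:p:]"
      by (simp add: var_t_def)
    then show ?case
      using add[OF 3 mult[OF t pCons.IH]] by metis
  qed (simp add: 0)
  show ?thesis
  proof (induction p)
    case (pCons a p)
    have "pCons a p = [:a:] + var_w * p"
      by (simp add: var_w_def)
    then show ?case
      using add[OF 4 mult[OF w pCons.IH]] by metis
  qed (simp add: 0)
qed

section \<open>Evaluation at complex points\<close>

definition ev :: "poly5 \<Rightarrow> complex \<Rightarrow> complex \<Rightarrow> complex \<Rightarrow> complex \<Rightarrow> complex \<Rightarrow> complex"
  where "ev p x y z t w =
    poly (poly (poly (poly (poly p [:[:[:[:w:]:]:]:]) [:[:[:t:]:]:]) [:[:z:]:]) [:y:]) x"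

lemma ev_hom [simp]:
  "ev 0 x y z t w = 0"
  "ev 1 x y z t w = 1"
  "ev (of_complex c) x y z t w = c"
  "ev (p + q) x y z t w = ev p x y z t w + ev q x y z t w"
  "ev (p - q) x y z t w = ev p x y z t w - ev q x y z t w"
  "ev (- p) x y z t w = - ev p x y z t w"
  "ev (p * q) x y z t w = ev p x y z t w * ev q x y z t w"
  "ev (p ^ n) x y z t w = ev p x y z t w ^ n"
  by (simp_all add: ev_def of_complex_poly5)

lemma ev_numeral [simp]: "ev (numeral n) x y z t w = numeral n"
  by (induction n) (simp_all only: numeral_One numeral_Bit0 numeral_Bit1 ev_hom)

lemma ev_var [simp]:
  "ev var_x x y z t w = x"
  "ev var_y x y z t w = y"
  "ev var_z x y z t w = z"
  "ev var_t x y z t w = t"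
  "ev var_w x y z t w = w"
  by (simp_all add: ev_def var_x_def var_y_def var_z_def var_t_def var_w_def)

lemma ev_koras_russell_poly [simp]:
  "ev koras_russell_poly x y z t w = x + x ^ 2 * y + z ^ 2 + t ^ 3"
  by (simp add: koras_russell_poly_def)

text \<open>The coefficients may themselves be polynomials; \<open>h\<close> embeds the complex
  numbers among them and so supplies infinitely many roots.\<close>

lemma poly_eq_0_if_infinite_roots:
  fixes p :: "'a::idom poly"
  assumes "inj h" "\<And>c :: complex. poly p (h c) = 0"
  shows "p = 0"
proof (rule ccontr)
  assume "p \<noteq> 0"
  then have "finite {a. poly p a = 0}"
    by (rule poly_roots_finite)
  moreover have "range h \<subseteq> {a. poly p a = 0}"
    using assms(2) by auto
  ultimately have "finite (range h)"
    by (rule finite_subset[rotated])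
  then show False
    using finite_imageD[OF _ assms(1)] infinite_UNIV_char_0[where 'a = complex] by blast
qed

lemma poly5_eq_0I:
  assumes "\<And>x y z t w. ev p x y z t w = 0"
  shows "p = 0"
proof -
  have "poly (poly (poly (poly p [:[:[:[:w:]:]:]:]) [:[:[:t:]:]:]) [:[:z:]:]) [:y:] = 0" for y z t w
    by (rule poly_eq_0_if_infinite_roots[of id]) (use assms in \<open>simp_all add: ev_def\<close>)
  then have "poly (poly (poly p [:[:[:[:w:]:]:]:]) [:[:[:t:]:]:]) [:[:z:]:] = 0" for z t w
    by (intro poly_eq_0_if_infinite_roots[of "\<lambda>y. [:y:]"]) (simp_all add: inj_def)
  then have "poly (poly p [:[:[:[:w:]:]:]:]) [:[:[:t:]:]:] = 0" for t w
    by (intro poly_eq_0_if_infinite_roots[of "\<lambda>y. [:[:y:]:]"]) (simp_all add: inj_def)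
  then have "poly p [:[:[:[:w:]:]:]:] = 0" for w
    by (intro poly_eq_0_if_infinite_roots[of "\<lambda>y. [:[:[:y:]:]:]"]) (simp_all add: inj_def)
  then show ?thesis
    by (intro poly_eq_0_if_infinite_roots[of "\<lambda>y. [:[:[:[:y:]:]:]:]"]) (simp_all add: inj_def)
qed

section \<open>Polynomial vector fields on affine five-space and their integral curves\<close>

text \<open>This is \<open>a \<partial>\<^sub>x + b \<partial>\<^sub>y + c \<partial>\<^sub>z + d
  \<partial>\<^sub>t + e \<partial>\<^sub>w\<close>. Each \<open>map_poly\<close> descends by one
  variable, so the innermost \<open>x\<close> takes four and the outermost \<open>w\<close>
  none.\<close>

definition vector_field ::
    "poly5 \<Rightarrow> poly5 \<Rightarrow> poly5 \<Rightarrow> poly5 \<Rightarrow> poly5 \<Rightarrow> poly5 \<Rightarrow> poly5"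
  where "vector_field a b c d e p =
    a * map_poly (map_poly (map_poly (map_poly pderiv))) p +
    (b * map_poly (map_poly (map_poly pderiv)) p +
    (c * map_poly (map_poly pderiv) p +
    (d * map_poly pderiv p + e * pderiv p)))"

lemma complex_derivation_vector_field: "complex_derivation (vector_field a b c d e)"
  unfolding vector_field_def[abs_def]
  by (intro complex_derivation_plus complex_derivation_times complex_derivation_map_poly
      complex_derivation_pderiv)

lemmas complex_derivation_partial =
  complex_derivation_pderiv
  complex_derivation_map_poly[OF complex_derivation_pderiv]
  complex_derivation_map_poly[OF complex_derivation_map_poly[OF complex_derivation_pderiv]]
  complex_derivation_map_poly[OF complex_derivation_map_poly[OF complex_derivation_map_poly[OF
    complex_derivation_pderiv]]]
  complex_derivation_map_poly[OF complex_derivation_map_poly[OF complex_derivation_map_poly[OF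
    complex_derivation_map_poly[OF complex_derivation_pderiv]]]]

lemma vector_field_var [simp]:
  "vector_field a b c d e var_x = a"
  "vector_field a b c d e var_y = b"
  "vector_field a b c d e var_z = c"
  "vector_field a b c d e var_t = d"
  "vector_field a b c d e var_w = e"
  by (simp_all add: vector_field_def var_x_def var_y_def var_z_def var_t_def var_w_def
      map_poly_pCons pderiv_pCons derivation_1[OF complex_derivation_partial(1)]
      derivation_1[OF complex_derivation_partial(2)] derivation_1[OF complex_derivation_partial(3)]
      derivation_1[OF complex_derivation_partial(4)]
      derivation_1[OF complex_derivation_partial(5)] flip: one_pCons)

lemma vector_field_koras_russell_poly:
  "vector_field a b c d e koras_russell_poly =
    (1 + 2 * var_x * var_y) * a + var_x ^ 2 * b + 2 * var_z * c + 3 * var_t ^ 2 * d"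
proof -
  \<comment> \<open>The left side is the literal Leibniz expansion with powers written as products,
    so that rewriting the goal produces an instance of this identity.\<close>
  have "a + (x * x * b + (x * a + a * x) * y) + (z * c + c * z) + (t * t * d + (t * d + d * t) * t) =
      (1 + 2 * x * y) * a + x * x * b + 2 * z * c + 3 * (t * t) * d"
    for x y z t a b c d :: "'a::idom"
    by algebra
  then show ?thesis
    unfolding koras_russell_poly_def power2_eq_square power3_eq_cube
    by (simp only: derivation_add[OF complex_derivation_vector_field]
        derivation_mult[OF complex_derivation_vector_field] vector_field_var)
qed

text \<open>Chain rule: along a curve on which the field is \<open>k\<close> times the velocity,
  \<open>D\<close> becomes \<open>k\<close> times \<open>d/ds\<close>. Both sides obey the Leibniz
  rule, so the five variables suffice. The factor \<open>k\<close> allows parametrisation by a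
  coordinate on which the field is not 1.\<close>

lemma restrict_to_curve:
  assumes D: "complex_derivation D"
    and X: "\<And>s. ev (D var_x) (poly X s) (poly Y s) (poly Z s) (poly T s) (poly W s) =
      k * poly (pderiv X) s"
    and Y: "\<And>s. ev (D var_y) (poly X s) (poly Y s) (poly Z s) (poly T s) (poly W s) =
      k * poly (pderiv Y) s"
    and Z: "\<And>s. ev (D var_z) (poly X s) (poly Y s) (poly Z s) (poly T s) (poly W s) =
      k * poly (pderiv Z) s"
    and T: "\<And>s. ev (D var_t) (poly X s) (poly Y s) (poly Z s) (poly T s) (poly W s) =
      k * poly (pderiv T) s"
    and W: "\<And>s. ev (D var_w) (poly X s) (poly Y s) (poly Z s) (poly T s) (poly W s) =
      k * poly (pderiv W) s"
  shows "\<exists>g. \<forall>s. ev p (poly X s) (poly Y s) (poly Z s) (poly T s) (poly W s) = poly g s \<and>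
    ev (D p) (poly X s) (poly Y s) (poly Z s) (poly T s) (poly W s) =
      k * poly (pderiv g) s"
    (is "\<exists>g. ?P p g")
proof (induction p rule: poly5_induct)
  case (const c)
  show ?case
    by (rule exI[of _ "[:c:]"]) (simp add: derivation_of_complex[OF D] pderiv_pCons)
next
  case (add p q)
  from add.IH(1) obtain g where g: "?P p g" ..
  from add.IH(2) obtain h where h: "?P q h" ..
  show ?case
    by (rule exI[of _ "g + h"])
      (simp add: g h derivation_add[OF D] pderiv_add distrib_left)
next
  case (mult p q)
  from mult.IH(1) obtain g where g: "?P p g" ..
  from mult.IH(2) obtain h where h: "?P q h" ..
  show ?case
    by (rule exI[of _ "g * h"])
      (simp add: g h derivation_mult[OF D] pderiv_mult algebra_simps)
next
  case x
  show ?case by (rule exI[of _ X]) (simp add: X)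
next
  case y
  show ?case by (rule exI[of _ Y]) (simp add: Y)
next
  case z
  show ?case by (rule exI[of _ Z]) (simp add: Z)
next
  case t
  show ?case by (rule exI[of _ T]) (simp add: T)
next
  case w
  show ?case by (rule exI[of _ W]) (simp add: W)
qed

lemma restrict_to_curve_const:
  assumes "complex_derivation D"
    and "\<And>s. ev (D var_x) (poly X s) (poly Y s) (poly Z s) (poly T s) (poly W s) =
      k * poly (pderiv X) s"
    and "\<And>s. ev (D var_y) (poly X s) (poly Y s) (poly Z s) (poly T s) (poly W s) =
      k * poly (pderiv Y) s"
    and "\<And>s. ev (D var_z) (poly X s) (poly Y s) (poly Z s) (poly T s) (poly W s) =
      k * poly (pderiv Z) s"
    and "\<And>s. ev (D var_t) (poly X s) (poly Y s) (poly Z s) (poly T s) (poly W s) =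
      k * poly (pderiv T) s"
    and "\<And>s. ev (D var_w) (poly X s) (poly Y s) (poly Z s) (poly T s) (poly W s) =
      k * poly (pderiv W) s"
    and "k \<noteq> 0"
    and "\<And>s. ev (D p) (poly X s) (poly Y s) (poly Z s) (poly T s) (poly W s) = 0"
  shows "ev p (poly X a) (poly Y a) (poly Z a) (poly T a) (poly W a) =
    ev p (poly X b) (poly Y b) (poly Z b) (poly T b) (poly W b)"
proof -
  obtain g where g: "\<And>s. ev p (poly X s) (poly Y s) (poly Z s) (poly T s) (poly W s) = poly g s"
    "\<And>s. ev (D p) (poly X s) (poly Y s) (poly Z s) (poly T s) (poly W s) =
      k * poly (pderiv g) s"
    using restrict_to_curve[of D X Y Z T W k p, OF assms(1-6)] by auto
  have "poly (pderiv g) s = 0" for s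
    using g(2)[of s] assms(7,8) by simp
  then have "pderiv g = 0"
    using poly_all_0_iff_0 by blast
  then obtain c where "g = [:c:]"
    using pderiv_iszero by blast
  then show ?thesis
    by (simp add: g(1))
qed

section \<open>The vanishing ideal of the cylinder\<close>

text \<open>Division by \<open>x\<close> with remainder. Freedom from \<open>x\<close> is expressed
  through values, a property that sums and products inherit at once.\<close>

lemma split_off_var_x:
  "\<exists>q1 q0. q = var_x * q1 + q0 \<and> (\<forall>x x' y z t w. ev q0 x y z t w = ev q0 x' y z t w)"
  (is "\<exists>q1 q0. ?P q q1 q0")
proof -
  have no_x: "\<exists>q1 q0. ?P q q1 q0" if "\<And>x x' y z t w. ev q x y z t w = ev q x' y z t w" for q
    by (rule exI[of _ 0], rule exI[of _ q]) (use that in simp)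
  show ?thesis
  proof (induction q rule: poly5_induct)
    case x
    have "?P var_x 1 0" by simp
    then show ?case by blast
  next
    case (add p q)
    then obtain p1 p0 q1 q0 where p: "p = var_x * p1 + p0" and q: "q = var_x * q1 + q0"
      and p0: "\<And>x x' y z t w. ev p0 x y z t w = ev p0 x' y z t w"
      and q0: "\<And>x x' y z t w. ev q0 x y z t w = ev q0 x' y z t w" by blast
    have "p + q = var_x * (p1 + q1) + (p0 + q0)"
      unfolding p q by (simp only: distrib_left add_ac)
    moreover have "\<forall>x x' y z t w. ev (p0 + q0) x y z t w = ev (p0 + q0) x' y z t w"
      unfolding ev_hom by (intro allI arg_cong2[where f = "(+)"] p0 q0)
    ultimately show ?case by blast
  next
    case (mult p q)
    then obtain p1 p0 q1 q0 where p: "p = var_x * p1 + p0" and q: "q = var_x * q1 + q0"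
      and p0: "\<And>x x' y z t w. ev p0 x y z t w = ev p0 x' y z t w"
      and q0: "\<And>x x' y z t w. ev q0 x y z t w = ev q0 x' y z t w" by blast
    have "p * q = var_x * (p1 * q + p0 * q1) + p0 * q0"
      unfolding p q by (simp only: distrib_left distrib_right add_ac mult_ac)
    moreover have "\<forall>x x' y z t w. ev (p0 * q0) x y z t w = ev (p0 * q0) x' y z t w"
      unfolding ev_hom by (intro allI arg_cong2[where f = "(*)"] p0 q0)
    ultimately show ?case by blast
  qed (rule no_x, simp)+
qed

text \<open>At \<open>x = 0\<close> the equation becomes \<open>z^2 + t^3\<close>, which is not
  zero; hence the \<open>x\<close>-free part of the quotient \<open>q\<close> vanishes and
  \<open>x\<close> can be cancelled.\<close>

lemma koras_russell_poly_dvd_cancel_x: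
  assumes "koras_russell_poly dvd var_x * p"
  shows "koras_russell_poly dvd p"
proof -
  obtain q where q: "var_x * p = koras_russell_poly * q"
    using assms by blast
  obtain q1 q0 where q': "q = var_x * q1 + q0"
    and q0: "\<And>x x' y z t w. ev q0 x y z t w = ev q0 x' y z t w"
    using split_off_var_x[of q] by blast
  have "(var_z ^ 2 + var_t ^ 3) * q0 = 0"
  proof (rule poly5_eq_0I)
    fix x y z t w
    have "ev (var_x * p) 0 y z t w = ev (koras_russell_poly * q) 0 y z t w"
      by (simp only: q)
    then show "ev ((var_z ^ 2 + var_t ^ 3) * q0) x y z t w = 0"
      using q0[of x y z t w 0] by (simp add: q')
  qed
  moreover have "var_z ^ 2 + var_t ^ 3 \<noteq> 0"
  proof
    assume "var_z ^ 2 + var_t ^ 3 = 0"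
    then have "ev (var_z ^ 2 + var_t ^ 3) 0 0 1 0 0 = 0"
      by (simp only: ev_hom)
    then show False by simp
  qed
  ultimately have "q0 = 0" by simp
  then have "var_x * p = var_x * (koras_russell_poly * q1)"
    using q q' by (simp add: algebra_simps)
  moreover have "var_x \<noteq> 0"
    by (simp add: var_x_def)
  ultimately have "p = koras_russell_poly * q1" by simp
  then show ?thesis by simp
qed

text \<open>Where \<open>x\<close> is invertible the equation can be solved for \<open>y\<close>; a
  power of \<open>x\<close> clears the denominators.\<close>

lemma eliminate_var_y:
  "\<exists>n g. koras_russell_poly dvd var_x ^ n * p - g \<and>
    (\<forall>x y y' z t w. ev g x y z t w = ev g x y' z t w)"
  (is "\<exists>n g. ?P p n g")
proof -
  have no_y: "\<exists>n g. ?P p n g" if "\<And>x y y' z t w. ev p x y z t w = ev p x y' z t w" for p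
    by (rule exI[of _ 0], rule exI[of _ p]) (use that in simp)
  show ?thesis
  proof (induction p rule: poly5_induct)
    case y
    have "var_x ^ 2 * var_y - - (var_x + var_z ^ 2 + var_t ^ 3) = koras_russell_poly"
      by (simp add: koras_russell_poly_def)
    then have "?P var_y 2 (- (var_x + var_z ^ 2 + var_t ^ 3))"
      by simp
    then show ?case by blast
  next
    case (add p q)
    then obtain n g m h
      where dvd: "koras_russell_poly dvd var_x ^ n * p - g" "koras_russell_poly dvd var_x ^ m * q - h"
        and g: "\<And>x y y' z t w. ev g x y z t w = ev g x y' z t w"
        and h: "\<And>x y y' z t w. ev h x y z t w = ev h x y' z t w" by blast
    have "koras_russell_poly dvd var_x ^ m * (var_x ^ n * p - g) + var_x ^ n * (var_x ^ m * q - h)"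
      by (intro dvd_add dvd_mult dvd)
    also have "\<dots> = var_x ^ (n + m) * (p + q) - (var_x ^ m * g + var_x ^ n * h)"
      unfolding power_add by (simp only: algebra_simps)
    finally have "koras_russell_poly dvd
        var_x ^ (n + m) * (p + q) - (var_x ^ m * g + var_x ^ n * h)" .
    moreover have "\<forall>x y y' z t w. ev (var_x ^ m * g + var_x ^ n * h) x y z t w =
        ev (var_x ^ m * g + var_x ^ n * h) x y' z t w"
      unfolding ev_hom ev_var
      by (intro allI arg_cong2[where f = "(+)"] arg_cong2[where f = "(*)"] g h refl)
    ultimately show ?case by blast
  next
    case (mult p q)
    then obtain n g m h
      where dvd: "koras_russell_poly dvd var_x ^ n * p - g" "koras_russell_poly dvd var_x ^ m * q - h"
        and g: "\<And>x y y' z t w. ev g x y z t w = ev g x y' z t w"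
        and h: "\<And>x y y' z t w. ev h x y z t w = ev h x y' z t w" by blast
    have "koras_russell_poly dvd (var_x ^ n * p) * (var_x ^ m * q) - g * h"
      using dvd by (rule dvd_diff_cong_mult)
    then have "koras_russell_poly dvd var_x ^ (n + m) * (p * q) - g * h"
      by (simp only: power_add mult_ac)
    moreover have "\<forall>x y y' z t w. ev (g * h) x y z t w = ev (g * h) x y' z t w"
      unfolding ev_hom by (intro allI arg_cong2[where f = "(*)"] g h)
    ultimately show ?case by blast
  qed (rule no_y, simp)+
qed

lemma ev_eq_0_if_dvd:
  assumes "koras_russell_poly dvd p" "x + x ^ 2 * y + z ^ 2 + t ^ 3 = 0"
  shows "ev p x y z t w = 0"
  using assms by (auto elim!: dvdE)

text \<open>A Nullstellensatz for this hypersurface that tests only points with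
  \<open>x \<noteq> 0\<close>. After elimination of \<open>y\<close> the remaining \<open>g\<close>
  has free arguments, since any \<open>x \<noteq> 0\<close>, \<open>z\<close>, \<open>t\<close>,
  \<open>w\<close> lift to a point of the cylinder. So \<open>g = 0\<close>, and the power of
  \<open>x\<close> is cancelled.\<close>

lemma koras_russell_poly_dvdI:
  assumes p: "\<And>x y z t w. x \<noteq> 0 \<Longrightarrow> x + x ^ 2 * y + z ^ 2 + t ^ 3 = 0 \<Longrightarrow> ev p x y z t w = 0"
  shows "koras_russell_poly dvd p"
proof -
  obtain n g where dvd: "koras_russell_poly dvd var_x ^ n * p - g"
    and g: "\<And>x y y' z t w. ev g x y z t w = ev g x y' z t w"
    using eliminate_var_y[of p] by blast
  \<comment> \<open>The extra factor makes the values vanish at \<open>x = 0\<close>, where the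
    equation cannot be solved for \<open>y\<close>.\<close>
  have "var_x * g = 0"
  proof (rule poly5_eq_0I)
    fix x y z t w
    show "ev (var_x * g) x y z t w = 0"
    proof (cases "x = 0")
      case False
      define y' where "y' = - (x + z ^ 2 + t ^ 3) / x ^ 2"
      have on: "x + x ^ 2 * y' + z ^ 2 + t ^ 3 = 0"
        using False by (simp add: y'_def)
      have "ev g x y' z t w = 0"
        using ev_eq_0_if_dvd[OF dvd on, of w] p[OF False on, of w] by simp
      then show ?thesis
        using g[of x y z t w y'] by simp
    qed simp
  qed
  then have "g = 0"
    by (simp add: var_x_def)
  with dvd have "koras_russell_poly dvd var_x ^ n * p"
    by simp
  then show ?thesis
    by (induction n) (auto simp: mult.assoc dest: koras_russell_poly_dvd_cancel_x)
qed

section \<open>Derivations of the coordinate ring\<close>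

abbreviation cls :: "poly5 \<Rightarrow> koras_russell_cylinder"
  where "cls \<equiv> abs_koras_russell_cylinder"

lemma cls_hom:
  "cls 0 = 0" "cls 1 = 1" "cls (of_complex c) = of_complex c"
  "cls (p + q) = cls p + cls q" "cls (p - q) = cls p - cls q" "cls (- p) = - cls p"
  "cls (p * q) = cls p * cls q"
  by (simp_all only: zero_koras_russell_cylinder.abs_eq one_koras_russell_cylinder.abs_eq
      of_complex_koras_russell_cylinder.abs_eq plus_koras_russell_cylinder.abs_eq
      minus_koras_russell_cylinder.abs_eq uminus_koras_russell_cylinder.abs_eq
      times_koras_russell_cylinder.abs_eq)

lemma cls_power: "cls (p ^ n) = cls p ^ n"
  by (induction n) (simp_all only: power_0 power_Suc cls_hom)

lemma cls_numeral: "cls (numeral n) = numeral n"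
  by (induction n) (simp_all only: numeral_One numeral_Bit0 numeral_Bit1 cls_hom)

lemma cls_eq_iff: "cls p = cls q \<longleftrightarrow> koras_russell_poly dvd p - q"
  by (simp only: koras_russell_cylinder.abs_eq_iff koras_russell_cong_def)

lemma cls_eq_0_iff: "cls p = 0 \<longleftrightarrow> koras_russell_poly dvd p"
  using cls_eq_iff[of p 0] by (simp add: cls_hom)

lemma cls_cases: obtains p where "f = cls p"
  by (metis Quotient_abs_rep[OF Quotient_koras_russell_cylinder])

text \<open>Evaluated on a chosen representative; the choice becomes immaterial once
  \<open>D\<close> maps the ideal of the hypersurface into itself.\<close>

definition induced :: "(poly5 \<Rightarrow> poly5) \<Rightarrow> koras_russell_cylinder \<Rightarrow> koras_russell_cylinder"
  where "induced D f = cls (D (rep_koras_russell_cylinder f))"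

context
  fixes D :: "poly5 \<Rightarrow> poly5"
  assumes D: "complex_derivation D" and tangent: "koras_russell_poly dvd D koras_russell_poly"
begin

text \<open>Two representatives differ by a multiple of the equation, and by the Leibniz rule and
  \<open>tangent\<close> so do their images.\<close>

lemma induced_cls: "induced D (cls p) = cls (D p)"
proof -
  define q where "q = rep_koras_russell_cylinder (cls p)"
  have "cls q = cls p"
    unfolding q_def by (rule Quotient_abs_rep[OF Quotient_koras_russell_cylinder])
  then obtain r where "q - p = koras_russell_poly * r"
    unfolding cls_eq_iff by blast
  then have "D q - D p = koras_russell_poly * D r + D koras_russell_poly * r"
    by (metis derivation_diff[OF D] derivation_mult[OF D])
  then have "cls (D q) = cls (D p)"
    unfolding cls_eq_iff using tangent by simp
  then show ?thesis
    by (simp add: induced_def q_def)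
qed

lemma complex_derivation_induced: "complex_derivation (induced D)"
proof -
  have "induced D (f + g) = induced D f + induced D g" for f g
    by (cases f rule: cls_cases, cases g rule: cls_cases)
      (simp add: induced_cls derivation_add[OF D] flip: cls_hom)
  moreover have "induced D (f * g) = f * induced D g + induced D f * g" for f g
    by (cases f rule: cls_cases, cases g rule: cls_cases)
      (simp add: induced_cls derivation_mult[OF D] flip: cls_hom)
  moreover have "induced D (of_complex c * f) = of_complex c * induced D f" for c f
    by (cases f rule: cls_cases)
      (simp add: induced_cls derivation_scale[OF D] flip: cls_hom)
  ultimately show ?thesis
    unfolding complex_derivation_def by blast
qed

text \<open>The nilpotent part is a subalgebra, so nilpotency on the five generators makes the
  induced derivation locally nilpotent, and invariants lie in its kernel.\<close>

lemma makar_limanov_dvd: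
  assumes ml: "cls p \<in> makar_limanov"
    and "cls var_x \<in> nilpotent_part (induced D)" "cls var_y \<in> nilpotent_part (induced D)"
      "cls var_z \<in> nilpotent_part (induced D)" "cls var_t \<in> nilpotent_part (induced D)"
      "cls var_w \<in> nilpotent_part (induced D)"
  shows "koras_russell_poly dvd D p"
proof -
  note I = complex_derivation_induced
  have "cls q \<in> nilpotent_part (induced D)" for q
    by (induction q rule: poly5_induct)
      (simp_all add: assms(2-) cls_hom nilpotent_part_of_complex[OF I] nilpotent_part_add[OF I]
        nilpotent_part_mult[OF I])
  then have "f \<in> nilpotent_part (induced D)" for f
    by (metis cls_cases)
  then have "locally_nilpotent (induced D)"
    using derivation_0[OF I] by (rule locally_nilpotentI[rotated])
  then have "induced D (cls p) = 0"
    using ml I by (auto simp: makar_limanov_def)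
  then show ?thesis
    by (simp add: induced_cls cls_eq_0_iff)
qed

end

section \<open>Conditions on invariants from particular locally nilpotent derivations\<close>

lemma makar_limanov_dvd_w:
  assumes "cls p \<in> makar_limanov"
  shows "koras_russell_poly dvd vector_field 0 0 0 0 1 p"
proof (rule makar_limanov_dvd[OF _ _ assms])
  let ?D = "vector_field 0 0 0 0 1"
  show D: "complex_derivation ?D"
    by (rule complex_derivation_vector_field)
  show tangent: "koras_russell_poly dvd ?D koras_russell_poly"
    by (simp add: vector_field_koras_russell_poly)
  note I = complex_derivation_induced[OF D tangent]
  note on_cls = induced_cls[OF D tangent]
  show "cls var_x \<in> nilpotent_part (induced ?D)" "cls var_y \<in> nilpotent_part (induced ?D)"
    "cls var_z \<in> nilpotent_part (induced ?D)" "cls var_t \<in> nilpotent_part (induced ?D)"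
    by (rule nilpotent_part_kernel[OF I], simp add: on_cls cls_hom)+
  show "cls var_w \<in> nilpotent_part (induced ?D)"
    by (rule nilpotent_part_step[OF I], simp add: on_cls cls_hom nilpotent_part_1[OF I])
qed

text \<open>Tangency is the cancellation of \<open>x^2 * (- 2 z)\<close> against
  \<open>2 z * x^2\<close>. The field is triangular: \<open>x\<close> is killed, \<open>z\<close>
  goes to \<open>x^2\<close>, and \<open>y\<close> to a multiple of \<open>z\<close>.\<close>

lemma makar_limanov_dvd_z:
  assumes "cls p \<in> makar_limanov"
  shows "koras_russell_poly dvd vector_field 0 (- (2 * var_z)) (var_x ^ 2) 0 0 p"
proof (rule makar_limanov_dvd[OF _ _ assms])
  let ?D = "vector_field 0 (- (2 * var_z)) (var_x ^ 2) 0 0"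
  show D: "complex_derivation ?D"
    by (rule complex_derivation_vector_field)
  show tangent: "koras_russell_poly dvd ?D koras_russell_poly"
    by (simp add: vector_field_koras_russell_poly algebra_simps)
  note I = complex_derivation_induced[OF D tangent]
  note on_cls = induced_cls[OF D tangent]
  show x: "cls var_x \<in> nilpotent_part (induced ?D)" and "cls var_t \<in> nilpotent_part (induced ?D)"
    "cls var_w \<in> nilpotent_part (induced ?D)"
    by (rule nilpotent_part_kernel[OF I], simp add: on_cls cls_hom)+
  show z: "cls var_z \<in> nilpotent_part (induced ?D)"
    by (rule nilpotent_part_step[OF I])
      (simp add: on_cls cls_power x nilpotent_part_closed[OF I])
  show "cls var_y \<in> nilpotent_part (induced ?D)"
    by (rule nilpotent_part_step[OF I])
      (simp add: on_cls cls_hom cls_numeral z nilpotent_part_closed[OF I])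
qed

text \<open>The same pattern with the roles of \<open>z\<close> and \<open>t\<close> exchanged:
  \<open>t\<close> goes to \<open>x^2\<close> and \<open>y\<close> to a multiple of
  \<open>t^2\<close>.\<close>

lemma makar_limanov_dvd_t:
  assumes "cls p \<in> makar_limanov"
  shows "koras_russell_poly dvd vector_field 0 (- (3 * var_t ^ 2)) 0 (var_x ^ 2) 0 p"
proof (rule makar_limanov_dvd[OF _ _ assms])
  let ?D = "vector_field 0 (- (3 * var_t ^ 2)) 0 (var_x ^ 2) 0"
  show D: "complex_derivation ?D"
    by (rule complex_derivation_vector_field)
  show tangent: "koras_russell_poly dvd ?D koras_russell_poly"
    by (simp add: vector_field_koras_russell_poly algebra_simps)
  note I = complex_derivation_induced[OF D tangent]
  note on_cls = induced_cls[OF D tangent]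
  show x: "cls var_x \<in> nilpotent_part (induced ?D)" and "cls var_z \<in> nilpotent_part (induced ?D)"
    "cls var_w \<in> nilpotent_part (induced ?D)"
    by (rule nilpotent_part_kernel[OF I], simp add: on_cls cls_hom)+
  show t: "cls var_t \<in> nilpotent_part (induced ?D)"
    by (rule nilpotent_part_step[OF I])
      (simp add: on_cls cls_power x nilpotent_part_closed[OF I])
  show "cls var_y \<in> nilpotent_part (induced ?D)"
    by (rule nilpotent_part_step[OF I])
      (simp add: on_cls cls_hom cls_numeral cls_power t nilpotent_part_closed[OF I])
qed

text \<open>Away from \<open>t = 0\<close> the cylinder is also the cylinder with coordinate \<open>r\<close> over the Danielewski
  surface \<open>x s = v\<^sup>2 + t\<^sup>3\<close> over the \<open>t\<close>-line, where \<open>v\<close>, \<open>s\<close> and \<open>r\<close> are the functions below. The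
  vector field \<open>2 t\<^sup>3 (2 v \<partial>\<^sub>x + s \<partial>\<^sub>v)\<close> of this second cylinder extends to the whole of the first
  one, with the components below; these use
  \<open>2 t\<^sup>3 w = - v (1 + s) - x r\<close>, \<open>z = v - x w\<close> and \<open>2 t\<^sup>3 y = - 2 s (1 + s) - 2 r v - 2 t\<^sup>3 w\<^sup>2\<close>.\<close>

definition dan_v where "dan_v x z w = z + x * w" for x :: "'a::comm_ring_1"
definition dan_s where "dan_s x y z w = 2 * (z * w) + x * w ^ 2 - x * y - 1" for x :: "'a::comm_ring_1"
definition dan_r where "dan_r x y z w = y * z + 2 * w + 3 * (x * y * w) - 3 * (z * w ^ 2) - x * w ^ 3"
  for x :: "'a::comm_ring_1"
definition dan_dx where "dan_dx x z t w = 4 * t ^ 3 * dan_v x z w" for x :: "'a::comm_ring_1"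
definition dan_dw where "dan_dw x y z w =
    - (dan_s x y z w * (1 + dan_s x y z w) + 2 * dan_v x z w * dan_r x y z w)"
  for x :: "'a::comm_ring_1"
definition dan_dz where "dan_dz x y z t w =
    2 * t ^ 3 * dan_s x y z w - w * dan_dx x z t w - x * dan_dw x y z w"
  for x :: "'a::comm_ring_1"
definition dan_dy where "dan_dy x y z w =
    - 2 * (dan_r x y z w * dan_s x y z w + w * dan_dw x y z w)"
  for x :: "'a::comm_ring_1"

lemmas dan_defs = dan_v_def dan_s_def dan_r_def dan_dx_def dan_dw_def dan_dz_def dan_dy_def

text \<open>The left side is the derivative of the equation along the field, as given by
  \<open>vector_field_koras_russell_poly\<close> with zero \<open>t\<close>-component; the explicit
  cofactor shows tangency.\<close>

lemma dan_tangent: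
  fixes x y z t w :: "'a::idom"
  shows "(1 + 2 * x * y) * dan_dx x z t w + x ^ 2 * dan_dy x y z w + 2 * z * dan_dz x y z t w =
    (x + x ^ 2 * y + z ^ 2 + t ^ 3) * (4 * x * w - 4 * x * z * w ^ 2 + 4 * x * y * z + 8 * x ^ 2 * y * w)"
  unfolding dan_defs by algebra

text \<open>The left side is the Leibniz expansion of the derivative of \<open>dan_s\<close>; being
  a multiple of the equation, it puts \<open>s\<close> into the kernel on the cylinder.\<close>

lemma dan_derivative_s:
  fixes x y z t w :: "'a::idom"
  shows "2 * (z * dan_dw x y z w + dan_dz x y z t w * w) +
      (x * (2 * w * dan_dw x y z w) + dan_dx x z t w * w ^ 2) -
      (x * dan_dy x y z w + dan_dx x z t w * y) =
    (x + x ^ 2 * y + z ^ 2 + t ^ 3) * (-4 * w + 4 * z * w ^ 2 - 4 * y * z - 8 * x * y * w)"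
  unfolding dan_defs by algebra

text \<open>Likewise for \<open>dan_r\<close>, the free coordinate of the second cylinder, which the
  field does not move.\<close>

lemma dan_derivative_r:
  fixes x y z t w :: "'a::idom"
  shows "y * dan_dz x y z t w + dan_dy x y z w * z + 2 * dan_dw x y z w +
      3 * (x * y * dan_dw x y z w + (x * dan_dy x y z w + dan_dx x z t w * y) * w) -
      3 * (z * (2 * w * dan_dw x y z w) + dan_dz x y z t w * w ^ 2) -
      (x * (3 * w ^ 2 * dan_dw x y z w) + dan_dx x z t w * w ^ 3) =
    (x + x ^ 2 * y + z ^ 2 + t ^ 3) * (6 * w ^ 2 - 4 * z * w ^ 3 - 2 * y + 12 * y * z * w +
      2 * x * w ^ 4 + 16 * x * y * w ^ 2 - 2 * x * y ^ 2)"
  unfolding dan_defs by algebra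

text \<open>In the coordinates of the second cylinder the field is triangular: \<open>s\<close>,
  \<open>r\<close> and \<open>t\<close> are killed, \<open>v\<close> goes to \<open>2 t^3 s\<close>,
  and \<open>x\<close> to \<open>4 t^3 v\<close>. The original generators follow from these.\<close>

lemma makar_limanov_dvd_dan:
  assumes "cls p \<in> makar_limanov"
  shows "koras_russell_poly dvd vector_field (dan_dx var_x var_z var_t var_w)
    (dan_dy var_x var_y var_z var_w) (dan_dz var_x var_y var_z var_t var_w) 0
    (dan_dw var_x var_y var_z var_w) p"
proof -
  define D where "D = vector_field (dan_dx var_x var_z var_t var_w)
    (dan_dy var_x var_y var_z var_w) (dan_dz var_x var_y var_z var_t var_w) 0
    (dan_dw var_x var_y var_z var_w)"
  have D: "complex_derivation D"
    unfolding D_def by (rule complex_derivation_vector_field)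
  have D_var: "D var_x = dan_dx var_x var_z var_t var_w" "D var_y = dan_dy var_x var_y var_z var_w"
    "D var_z = dan_dz var_x var_y var_z var_t var_w" "D var_t = 0"
    "D var_w = dan_dw var_x var_y var_z var_w"
    unfolding D_def by (rule vector_field_var)+
  have tangent: "koras_russell_poly dvd D koras_russell_poly"
    unfolding D_def vector_field_koras_russell_poly mult_zero_right add_0_right dan_tangent
      koras_russell_poly_def[symmetric] by (rule dvd_triv_left)
  note I = complex_derivation_induced[OF D tangent]
  note on_cls = induced_cls[OF D tangent]
  note D_rules = derivation_add[OF D] derivation_diff[OF D] derivation_numeral[OF D]
    derivation_power2[OF D] derivation_power3[OF D] derivation_1[OF D] derivation_mult[OF D]
    D_var diff_zero mult_zero_left add_0_right
  have "koras_russell_poly dvd D (dan_s var_x var_y var_z var_w)"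
    unfolding dan_s_def[of var_x] D_rules dan_derivative_s koras_russell_poly_def[symmetric]
    by (rule dvd_triv_left)
  then have s: "cls (dan_s var_x var_y var_z var_w) \<in> nilpotent_part (induced D)"
    by (intro nilpotent_part_kernel[OF I]) (simp only: on_cls cls_eq_0_iff)
  have "koras_russell_poly dvd D (dan_r var_x var_y var_z var_w)"
    unfolding dan_r_def[of var_x] D_rules dan_derivative_r koras_russell_poly_def[symmetric]
    by (rule dvd_triv_left)
  then have r: "cls (dan_r var_x var_y var_z var_w) \<in> nilpotent_part (induced D)"
    by (intro nilpotent_part_kernel[OF I]) (simp only: on_cls cls_eq_0_iff)
  have t: "cls var_t \<in> nilpotent_part (induced D)"
    by (intro nilpotent_part_kernel[OF I]) (simp only: on_cls D_var cls_hom)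
  \<comment> \<open>This holds exactly, not only modulo the equation: \<open>dan_dz\<close> is the
    component that it forces.\<close>
  have Dv: "D (dan_v var_x var_z var_w) = 2 * var_t ^ 3 * dan_s var_x var_y var_z var_w"
    unfolding dan_v_def[of var_x] D_rules dan_dz_def by (simp add: mult.commute)
  have v: "cls (dan_v var_x var_z var_w) \<in> nilpotent_part (induced D)"
    by (rule nilpotent_part_step[OF I])
      (simp only: on_cls Dv cls_hom cls_power cls_numeral s t nilpotent_part_closed[OF I])
  have x: "cls var_x \<in> nilpotent_part (induced D)"
    by (rule nilpotent_part_step[OF I])
      (simp only: on_cls D_var dan_dx_def cls_hom cls_power cls_numeral v t
        nilpotent_part_closed[OF I])
  \<comment> \<open>The components at \<open>w\<close>, \<open>z\<close> and \<open>y\<close> are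
    polynomials in elements already shown nilpotent; \<open>w\<close> comes first because the other
    two components contain it.\<close>
  have dw: "cls (dan_dw var_x var_y var_z var_w) \<in> nilpotent_part (induced D)"
    by (simp only: dan_dw_def cls_hom cls_numeral s v r nilpotent_part_closed[OF I])
  have w: "cls var_w \<in> nilpotent_part (induced D)"
    by (rule nilpotent_part_step[OF I]) (simp only: on_cls D_var dw)
  have z: "cls var_z \<in> nilpotent_part (induced D)"
    by (rule nilpotent_part_step[OF I])
      (simp only: on_cls D_var dan_dz_def dan_dx_def cls_hom cls_power cls_numeral
        x t v s w dw nilpotent_part_closed[OF I])
  have y: "cls var_y \<in> nilpotent_part (induced D)"
    by (rule nilpotent_part_step[OF I])
      (simp only: on_cls D_var dan_dy_def cls_hom cls_numeral
        r s w dw nilpotent_part_closed[OF I])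
  show ?thesis
    using makar_limanov_dvd[OF D tangent assms x y z t w] unfolding D_def .
qed

section \<open>The Makar-Limanov invariant\<close>

text \<open>The \<open>y\<close>-coordinate of the only point of the threefold over given
  \<open>x \<noteq> 0\<close>, \<open>z\<close>, \<open>t\<close>.\<close>

definition height :: "complex \<Rightarrow> complex \<Rightarrow> complex \<Rightarrow> complex"
  where "height x z t = - (x + z ^ 2 + t ^ 3) / x ^ 2"

lemma height_on: "x \<noteq> 0 \<Longrightarrow> x + x ^ 2 * height x z t + z ^ 2 + t ^ 3 = 0"
  by (simp add: height_def)

lemma height_unique: "x \<noteq> 0 \<Longrightarrow> x + x ^ 2 * y + z ^ 2 + t ^ 3 = 0 \<Longrightarrow> y = height x z t"
  by (simp add: height_def field_simps add_eq_0_iff)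

lemma makar_limanov_const_w:
  assumes "cls p \<in> makar_limanov" "x \<noteq> 0"
  shows "ev p x (height x z t) z t a = ev p x (height x z t) z t b"
  using restrict_to_curve_const[of "vector_field 0 0 0 0 1" "[:x:]" "[:height x z t:]" "[:z:]" "[:t:]"
      "[:0, 1:]" 1 p a b]
    ev_eq_0_if_dvd[OF makar_limanov_dvd_w[OF assms(1)] height_on[OF assms(2)]]
  by (simp add: complex_derivation_vector_field pderiv_pCons)

text \<open>The integral curve through fixed \<open>x\<close>, \<open>t\<close>, \<open>w\<close> is
  a parabola parametrised by \<open>z\<close>. The field moves \<open>z\<close> at speed
  \<open>x^2\<close>, which is therefore the nonzero factor \<open>k\<close>.\<close>

lemma makar_limanov_const_z:
  assumes "cls p \<in> makar_limanov" "x \<noteq> 0"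
  shows "ev p x (height x a t) a t w = ev p x (height x b t) b t w"
proof -
  \<comment> \<open>\<open>height\<close> as a polynomial in its second argument.\<close>
  define Y where "Y = [:- (x + t ^ 3) / x ^ 2, 0, - 1 / x ^ 2:]"
  have Y: "poly Y s = height x s t" "x ^ 2 * poly (pderiv Y) s = - (2 * s)" for s
    using assms(2) by (simp_all add: Y_def height_def pderiv_pCons field_simps power2_eq_square)
  show ?thesis
    using restrict_to_curve_const[of "vector_field 0 (- (2 * var_z)) (var_x ^ 2) 0 0" "[:x:]" Y
        "[:0, 1:]" "[:t:]" "[:w:]" "x ^ 2" p a b]
      ev_eq_0_if_dvd[OF makar_limanov_dvd_z[OF assms(1)] height_on[OF assms(2)]] assms(2)
    by (simp add: complex_derivation_vector_field pderiv_pCons Y)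
qed

lemma makar_limanov_const_t:
  assumes "cls p \<in> makar_limanov" "x \<noteq> 0"
  shows "ev p x (height x z a) z a w = ev p x (height x z b) z b w"
proof -
  \<comment> \<open>\<open>height\<close> as a polynomial in its third argument.\<close>
  define Y where "Y = [:- (x + z ^ 2) / x ^ 2, 0, 0, - 1 / x ^ 2:]"
  have Y: "poly Y s = height x z s" "x ^ 2 * poly (pderiv Y) s = - (3 * s ^ 2)" for s
    using assms(2)
    by (simp_all add: Y_def height_def pderiv_pCons field_simps power2_eq_square power3_eq_cube)
  show ?thesis
    using restrict_to_curve_const[of "vector_field 0 (- (3 * var_t ^ 2)) 0 (var_x ^ 2) 0" "[:x:]" Y
        "[:z:]" "[:0, 1:]" "[:w:]" "x ^ 2" p a b]
      ev_eq_0_if_dvd[OF makar_limanov_dvd_t[OF assms(1)] height_on[OF assms(2)]] assms(2)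
    by (simp add: complex_derivation_vector_field pderiv_pCons Y)
qed

definition of_poly_x :: "complex poly \<Rightarrow> poly5"
  where "of_poly_x h = [:[:[:[:h:]:]:]:]"

lemma ev_of_poly_x [simp]: "ev (of_poly_x h) x y z t w = poly h x"
  by (simp add: of_poly_x_def ev_def)

lemma vector_field_of_poly_x: "vector_field a b c d e (of_poly_x h) = a * of_poly_x (pderiv h)"
  by (simp add: of_poly_x_def vector_field_def map_poly_pCons pderiv_pCons)

text \<open>Moving along \<open>w\<close>, then \<open>z\<close>, then \<open>t\<close> carries
  every point with \<open>x \<noteq> 0\<close> to the section without changing the value of
  \<open>p\<close>. As the section extends over \<open>x = 0\<close>, the common value is a
  polynomial in \<open>x\<close>, not merely a Laurent polynomial.\<close>

lemma makar_limanov_eq_of_poly_x: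
  assumes "cls p \<in> makar_limanov"
  obtains h where "cls p = cls (of_poly_x h)"
proof -
  \<comment> \<open>The zero derivation with \<open>k = 0\<close> reduces
    \<open>restrict_to_curve\<close> to the fact that \<open>p\<close> restricts to a polynomial on
    a polynomial curve.\<close>
  have "complex_derivation (\<lambda>_ :: poly5. 0 :: poly5)"
    by (simp add: complex_derivation_def)
  \<comment> \<open>The curve \<open>(s, - 1 / 4, 1 - s / 2, - 1, 0)\<close> is a section of the projection to \<open>x\<close>.\<close>
  from restrict_to_curve[OF this, of "[:0, 1:]" "[:- 1 / 4:]" "[:1, - 1 / 2:]" "[:- 1:]" "[:0:]" 0 p]
  obtain h where h: "\<And>s. ev p s (- 1 / 4) (1 - s / 2) (- 1) 0 = poly h s"
    by auto
  have "koras_russell_poly dvd p - of_poly_x h"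
  proof (rule koras_russell_poly_dvdI)
    fix x y z t w :: complex
    assume x: "x \<noteq> 0" and on: "x + x ^ 2 * y + z ^ 2 + t ^ 3 = 0"
    have height: "height x (1 - x / 2) (- 1) = - 1 / 4"
      using x by (simp add: height_def field_simps power2_eq_square)
    have "ev p x y z t w = ev p x (height x z t) z t 0"
      using makar_limanov_const_w[OF assms x] height_unique[OF x on] by metis
    also have "\<dots> = ev p x (height x (1 - x / 2) t) (1 - x / 2) t 0"
      by (rule makar_limanov_const_z[OF assms x])
    also have "\<dots> = ev p x (height x (1 - x / 2) (- 1)) (1 - x / 2) (- 1) 0"
      by (rule makar_limanov_const_t[OF assms x])
    also have "\<dots> = poly h x"
      unfolding height by (rule h)
    finally show "ev (p - of_poly_x h) x y z t w = 0"
      by simp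
  qed
  then show ?thesis
    using that cls_eq_iff by blast
qed

theorem mainTheorem1:
  "(makar_limanov :: koras_russell_cylinder set) = range of_complex"
proof
  show "range of_complex \<subseteq> (makar_limanov :: koras_russell_cylinder set)"
    by (auto simp: makar_limanov_def derivation_of_complex)
  show "(makar_limanov :: koras_russell_cylinder set) \<subseteq> range of_complex"
  proof
    fix f :: koras_russell_cylinder
    assume f: "f \<in> makar_limanov"
    obtain h where h: "f = cls (of_poly_x h)"
      using f makar_limanov_eq_of_poly_x by (metis cls_cases)
    have "koras_russell_poly dvd dan_dx var_x var_z var_t var_w * of_poly_x (pderiv h)"
      using makar_limanov_dvd_dan[of "of_poly_x h"] f unfolding h vector_field_of_poly_x .
    \<comment> \<open>At \<open>z = t = 1\<close>, \<open>w = 0\<close> the factor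
      \<open>dan_dx\<close> has the value 4, so the derivative of \<open>h\<close> must vanish at
      every \<open>x \<noteq> 0\<close>.\<close>
    from ev_eq_0_if_dvd[OF this height_on[of _ 1 1], of _ 0]
    have "poly (pderiv h) x = 0" if "x \<noteq> 0" for x
      using that by (simp add: dan_dx_def dan_v_def)
    \<comment> \<open>Multiplication by the variable covers the missing argument 0.\<close>
    then have "poly (pderiv h * [:0, 1:]) x = 0" for x
      by (cases "x = 0") simp_all
    then have "pderiv h * [:0, 1:] = 0"
      using poly_all_0_iff_0 by blast
    then have "pderiv h = 0"
      by simp
    then obtain c where "h = [:c:]"
      using pderiv_iszero by blast
    then have "f = of_complex c"
      using cls_hom(3)[of c] by (simp add: h of_poly_x_def of_complex_poly5)
    then show "f \<in> range of_complex"
      by simp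
  qed
qed

end
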